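(* Let $q\in\mathbb N$, $q\ge3$, let $\Gamma=\Gamma_q$ be the Hecke triangle group, and let $D>0$. Then there are only finitely many reduced $\Gamma$-forms with discriminant at most $D$.
   Context: $G=\mathrm{PSL}_2(\mathbb R)$; $\lambda=2\cos(\pi/q)$; the Hecke triangle group $\Gamma=\Gamma_q\subset G$ is generated by $S=\begin{bmatrix}0&1\\-1&0\end{bmatrix}$ and $T=\begin{bmatrix}1&\lambda\\0&1\end{bmatrix}$. $G_h$ is the set of hyperbolic elements of $G$ (those with $|\mathrm{tr}|>2$), $\Gamma_h=\Gamma\cap G_h$. For real $A,B,C$ with discriminant $D(f)=B^2-4AC>0$ write $f=[A,B,C]$ for the indefinite quadratic form $Ax^2+Bxy+Cy^2$. A projective oriented quadratic form is a class $[f,s]=\{(f,s),(-f,-s)\}$ with $f=[A,B,C]$ an indefinite quadratic form ($A,B,C$ real, $B^2-4AC>0$) and $s\in\{\pm1\}$, also written $[A,B,C,s]$; $\mathrm{POQF}$ is the set of these. The discriminant of $[f,s]$ is $D(f)$. Put $x_\pm(f)=\frac{-B\pm\sqrt{D(f)}}{2A}$ if $A\neq0$; if $A=0$ then $x_+=-C/B,\ x_-=\infty$ for $B>0$, and $x_+=\infty,\ x_-=-C/B$ for $B<0$. The attracting zero $x_a([f,s])$ is $x_+(f)$ if $s=+1$ and $x_-(f)$ if $s=-1$; the repelling zero $x_r([f,s])$ is the other one. The bijection $\psi_2\colon\mathrm{POQF}\to G_h$ is given by $[A,B,C,s]\mapsto\begin{bmatrix}\frac{-B+s\sqrt{D+4}}2&-C\\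 A&\frac{B+s\sqrt{D+4}}2\end{bmatrix}$ with $D=B^2-4AC$. $\mathrm{POQF}(\Gamma_h)=\psi_2^{-1}(\Gamma_h)$ is the set of $\Gamma$-forms. A $\Gamma$-form $F$ is reduced if $x_a(F)>0>x_r(F)$ (with the order on $\mathbb R\cup\{\infty\}$ for which $r<\infty$ for all $r\in\mathbb R$). *)

theory Defs
  imports "HOL-Analysis.Analysis" "HOL-Algebra.Generated_Groups"
begin

definition mat2 :: "real \<Rightarrow> real \<Rightarrow> real \<Rightarrow> real \<Rightarrow> real^2^2" where
  "mat2 a b c d = vector [vector [a, b], vector [c, d]]"

lemma mat2_nth [simp]:
  "mat2 a b c d $ 1 $ 1 = a" "mat2 a b c d $ 1 $ 2 = b"
  "mat2 a b c d $ 2 $ 1 = c" "mat2 a b c d $ 2 $ 2 = d"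
  by (simp_all add: mat2_def)

lemma uminus_mat2: "- mat2 a b c d = mat2 (- a) (- b) (- c) (- d)"
  by (simp add: vec_eq_iff forall_2)

lemma det_mat2: "det (mat2 a b c d) = a * d - b * c"
  by (simp add: det_2)

lemma trace_mat2: "trace (mat2 a b c d) = a + d"
  by (simp add: trace_def sum_2)

definition SL2R :: "(real^2^2) monoid" where
  "SL2R = \<lparr>carrier = {M. det M = 1}, mult = (**), one = mat 1\<rparr>"

definition PSL2R :: "(real^2^2) set monoid" where
  "PSL2R = SL2R Mod {mat 1, - mat 1}"

definition psl_class :: "real^2^2 \<Rightarrow> (real^2^2) set" where
  "psl_class M = {mat 1, - mat 1} #>\<^bsub>SL2R\<^esub> M"

lemma matrix_mul_uminus_left: "(- A) ** B = - (A ** B)" for A B :: "real^2^2"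
  by (simp add: vec_eq_iff matrix_matrix_mult_def sum_negf)

lemma matrix_mul_uminus_right: "A ** (- B) = - (A ** B)" for A B :: "real^2^2"
  by (simp add: vec_eq_iff matrix_matrix_mult_def sum_negf)

lemma psl_class_eq: "psl_class M = {M, - M}"
  by (auto simp: psl_class_def r_coset_def SL2R_def matrix_mul_uminus_left)

lemma det_uminus_2: "det (- A) = det A" for A :: "real^2^2"
  by (simp add: det_2)

lemma group_SL2R: "group SL2R"
proof (rule groupI)
  fix M assume "M \<in> carrier SL2R"
  then have M: "det M = 1" by (simp add: SL2R_def)
  then obtain N where N: "M ** N = mat 1" "N ** M = mat 1"
    by (metis invertible_def invertible_det_nz zero_neq_one)
  then have "det N = 1"
    by (metis M det_I det_mul mult.right_neutral)
  with N show "\<exists>N\<in>carrier SL2R. N \<otimes>\<^bsub>SL2R\<^esub> M = \<one>\<^bsub>SL2R\<^esub>"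
    by (auto simp: SL2R_def)
qed (auto simp: SL2R_def det_mul matrix_mul_assoc)

lemma normal_center: "{mat 1, - mat 1} \<lhd> SL2R"
proof -
  interpret group SL2R by (rule group_SL2R)
  have *: "\<one>\<^bsub>SL2R\<^esub> = mat 1" by (simp add: SL2R_def)
  have sub: "subgroup {mat 1, - mat 1} SL2R"
  proof (rule subgroupI)
    fix a assume "a \<in> {mat 1, - mat 1 :: real^2^2}"
    then have "a \<in> carrier SL2R" "a \<otimes>\<^bsub>SL2R\<^esub> a = \<one>\<^bsub>SL2R\<^esub>"
      by (auto simp: SL2R_def det_uminus_2 matrix_mul_uminus_left matrix_mul_uminus_right)
    then have "inv\<^bsub>SL2R\<^esub> a = a" by (simp add: inv_equality)
    then show "inv\<^bsub>SL2R\<^esub> a \<in> {mat 1, - mat 1}" using \<open>a \<in> {mat 1, - mat 1}\<close> by simp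
  qed (auto simp: SL2R_def det_uminus_2 matrix_mul_uminus_left matrix_mul_uminus_right)
  show ?thesis
    unfolding normal_def normal_axioms_def
  proof (intro conjI ballI group_SL2R sub)
    fix M assume "M \<in> carrier SL2R"
    show "{mat 1, - mat 1} #>\<^bsub>SL2R\<^esub> M = M <#\<^bsub>SL2R\<^esub> {mat 1, - mat 1}"
      by (auto simp: r_coset_def l_coset_def SL2R_def
          matrix_mul_uminus_left matrix_mul_uminus_right)
  qed
qed

lemma group_PSL2R: "group PSL2R"
  unfolding PSL2R_def by (rule normal.factorgroup_is_group[OF normal_center])

lemma psl_class_in_carrier: "det M = 1 \<Longrightarrow> psl_class M \<in> carrier PSL2R"
  by (auto simp: PSL2R_def FactGroup_def RCOSETS_def psl_class_def SL2R_def)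

definition hyperbolic_elements :: "(real^2^2) set set" where
  "hyperbolic_elements = {g \<in> carrier PSL2R. \<exists>M\<in>g. \<bar>trace M\<bar> > 2}"

definition hecke_lambda :: "nat \<Rightarrow> real" where
  "hecke_lambda q = 2 * cos (pi / real q)"

definition hecke_group :: "nat \<Rightarrow> (real^2^2) set set" where
  "hecke_group q = generate PSL2R
     {psl_class (mat2 0 1 (-1) 0), psl_class (mat2 1 (hecke_lambda q) 0 1)}"

lemma subgroup_hecke_group: "subgroup (hecke_group q) PSL2R"
  unfolding hecke_group_def
  by (rule group.generate_is_subgroup[OF group_PSL2R])
     (auto intro!: psl_class_in_carrier simp: det_mat2)

definition hecke_hyperbolic :: "nat \<Rightarrow> (real^2^2) set set" where
  "hecke_hyperbolic q = hecke_group q \<inter> hyperbolic_elements"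

text \<open>The triple \<open>(A, B, C)\<close> stands for the form \<open>A x\<^sup>2 + B x y + C y\<^sup>2\<close>.\<close>

type_synonym bqf = "real \<times> real \<times> real"

fun disc :: "bqf \<Rightarrow> real" where
  "disc (A, B, C) = B\<^sup>2 - 4 * A * C"

text \<open>The zeros of a form live in \<open>\<real> \<union> {\<infinity>}\<close>, viewed inside the extended reals so that
  \<open>r < \<infinity>\<close> for all real \<open>r\<close>; the value \<open>- \<infinity>\<close> is never taken.\<close>

fun x_plus :: "bqf \<Rightarrow> ereal" where
  "x_plus (A, B, C) =
     (if A \<noteq> 0 then ereal ((- B + sqrt (disc (A, B, C))) / (2 * A))
      else if B > 0 then ereal (- C / B) else \<infinity>)"

fun x_minus :: "bqf \<Rightarrow> ereal" where
  "x_minus (A, B, C) =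
     (if A \<noteq> 0 then ereal ((- B - sqrt (disc (A, B, C))) / (2 * A))
      else if B > 0 then \<infinity> else ereal (- C / B))"

fun poqf_rel :: "bqf \<times> int \<Rightarrow> bqf \<times> int \<Rightarrow> bool" where
  "poqf_rel (f, s) (g, t) \<longleftrightarrow>
     disc f > 0 \<and> s \<in> {1, -1} \<and> ((g, t) = (f, s) \<or> (g, t) = (- f, - s))"

lemma disc_uminus: "disc (- f) = disc f"
  by (cases f) simp

text \<open>The relation is reflexive only on pairs \<open>(f, s)\<close> with \<open>f\<close> indefinite and \<open>s = \<plusminus>1\<close>, so the
  partial quotient consists exactly of the projective oriented quadratic forms \<open>[f, s]\<close>.\<close>

quotient_type poqf = "bqf \<times> int" / partial: poqf_rel
proof (rule part_equivpI)
  show "\<exists>x. poqf_rel x x"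
    by (rule exI[of _ "((0, 1, 0), 1)"]) simp
  show "symp poqf_rel"
    by (rule sympI) (auto simp: disc_uminus)
  show "transp poqf_rel"
    by (rule transpI) (auto simp: disc_uminus)
qed

lift_definition poqf_disc :: "poqf \<Rightarrow> real" is "\<lambda>(f, s). disc f"
  by (auto simp: disc_uminus)

lemma x_plus_uminus: "disc f > 0 \<Longrightarrow> x_plus (- f) = x_minus f"
  by (cases f) (auto simp: divide_simps)

lemma x_minus_uminus: "disc f > 0 \<Longrightarrow> x_minus (- f) = x_plus f"
  by (metis disc_uminus minus_minus x_plus_uminus)

lift_definition attracting_zero :: "poqf \<Rightarrow> ereal" is
  "\<lambda>(f, s). if s = 1 then x_plus f else x_minus f"
  by (auto simp: x_plus_uminus x_minus_uminus disc_uminus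
      simp del: x_plus.simps x_minus.simps disc.simps uminus_Pair)

lift_definition repelling_zero :: "poqf \<Rightarrow> ereal" is
  "\<lambda>(f, s). if s = 1 then x_minus f else x_plus f"
  by (auto simp: x_plus_uminus x_minus_uminus disc_uminus
      simp del: x_plus.simps x_minus.simps disc.simps uminus_Pair)

fun psi2_matrix :: "bqf \<times> int \<Rightarrow> real^2^2" where
  "psi2_matrix ((A, B, C), s) =
     (let D = disc (A, B, C) in
        mat2 ((- B + of_int s * sqrt (D + 4)) / 2) (- C)
             A ((B + of_int s * sqrt (D + 4)) / 2))"

lemma psi2_matrix_uminus: "psi2_matrix (- f, - s) = - psi2_matrix (f, s)"
  by (cases f) (simp add: Let_def uminus_mat2 diff_divide_distrib add_divide_distrib)

lift_definition psi2 :: "poqf \<Rightarrow> (real^2^2) set" is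
  "\<lambda>p. psl_class (psi2_matrix p)"
proof -
  fix p p' assume pp: "poqf_rel p p'"
  obtain f s where "p = (f, s)" by (cases p)
  with pp have "p' = p \<or> p' = (- f, - s)" by (cases p') simp
  then show "psl_class (psi2_matrix p) = psl_class (psi2_matrix p')"
    using psi2_matrix_uminus[of f s] \<open>p = (f, s)\<close> by (auto simp: psl_class_eq)
qed

lemma psi2_in_hyperbolic_elements: "psi2 F \<in> hyperbolic_elements"
proof transfer
  fix p assume p: "poqf_rel p p"
  obtain A B C s where eq: "p = ((A, B, C), s)" by (metis prod.collapse)
  let ?D = "disc (A, B, C)"
  have D: "?D > 0" and s: "s = 1 \<or> s = -1"
    using p by (auto simp: eq)
  define r where "r = sqrt (?D + 4)"
  have r: "r\<^sup>2 = ?D + 4" "r > 2"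
    using D unfolding r_def by (auto intro: real_less_rsqrt)
  have M: "psi2_matrix p = mat2 ((- B + of_int s * r) / 2) (- C) A ((B + of_int s * r) / 2)"
    by (simp add: eq r_def Let_def)
  have "det (psi2_matrix p) = 1"
    using s r(1) by (auto simp: M det_mat2 field_simps power2_eq_square)
  moreover have "\<bar>trace (psi2_matrix p)\<bar> > 2"
    using s r(2) by (auto simp: M trace_mat2 diff_divide_distrib add_divide_distrib)
  ultimately show "psl_class (psi2_matrix p) \<in> hyperbolic_elements"
    unfolding hyperbolic_elements_def
    using psl_class_in_carrier[of "psi2_matrix p"] by (auto simp: psl_class_eq)
qed

definition gamma_forms :: "nat \<Rightarrow> poqf set" where
  "gamma_forms q = psi2 -` hecke_hyperbolic q"

definition reduced_form :: "poqf \<Rightarrow> bool" where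
  "reduced_form F \<longleftrightarrow> attracting_zero F > 0 \<and> 0 > repelling_zero F"

end

theory Submission imports Defs begin

text \<open>
  A reduced form with \<open>A \<noteq> 0\<close> has zeros of opposite sign, so \<open>A * C < 0\<close> and its discriminant is
  \<open>B\<^sup>2 + 4 * \<bar>A\<bar> * \<bar>C\<bar>\<close>. This alone bounds \<open>B\<close> and the product \<open>A * C\<close>. Finiteness is therefore a
  discreteness property of the Hecke group, needed in three forms: a nonzero entry of a matrix in
  the group has absolute value at least 1, which separates \<open>A\<close> and \<open>C\<close> from 0 and so bounds both;
  a hyperbolic element does not fix \<open>\<infinity>\<close>, which excludes \<open>A = 0\<close>; and only finitely many elements
  have entries below a given bound. As \<open>psi2\<close> is injective, the last fact bounds the number of forms.

  All three come from writing the group by nonnegative matrices. Let \<open>U = - T S\<close>, an elliptic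
  matrix with \<open>U ^ q = - 1\<close>. For \<open>0 < k < q\<close> the matrix \<open>U ^ k S\<close> has the entries
  \<open>sin (j \<pi> / q) / sin (\<pi> / q)\<close> with \<open>j \<in> {k - 1, k, k + 1}\<close>, each of which is 0 or at least 1. The
  group is generated by \<open>S\<close> and \<open>U\<close>, and \<open>S\<^sup>2 = - 1\<close>, so up to sign every element is a product of
  these blocks with possibly one \<open>S\<close> added at either end (\<open>hecke_group_subset_words\<close>). Multiplication
  by \<open>S\<close> only permutes entries up to sign, and products of matrices with entries in
  \<open>{0} \<union> [1, \<infinity>)\<close> have entries of the same kind (\<open>hecke_words_gapped\<close>). If the lower left entry is
  0, the diagonal entries have product 1 and both have absolute value at least 1, hence exactly 1,
  and the trace is at most 2 in absolute value. Finally each block adds at least 1 to the sum of the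
  entries of a product (\<open>block_prod_entries\<close>), so bounded entries mean bounded word length
  (\<open>finite_hecke_words_bounded\<close>).
\<close>

section \<open>Two by two matrices\<close>

lemma mat2_mult: "mat2 a b c d ** mat2 a' b' c' d' =
    mat2 (a * a' + b * c') (a * b' + b * d') (c * a' + d * c') (c * b' + d * d')"
  by (simp add: vec_eq_iff forall_2 matrix_matrix_mult_def sum_2)

lemma mat2_one: "mat 1 = mat2 1 0 0 1"
  by (simp add: vec_eq_iff forall_2 mat_def)

lemma mat2_inject: "mat2 a b c d = mat2 a' b' c' d' \<longleftrightarrow> a = a' \<and> b = b' \<and> c = c' \<and> d = d'"
  by (metis mat2_nth)

section \<open>The blocks\<close>

definition invol :: "real^2^2" where
  "invol = mat2 0 1 (-1) 0"

text \<open>The matrix \<open>- T S\<close>, which has order \<open>q\<close> modulo sign.\<close>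

definition rot :: "nat \<Rightarrow> real^2^2" where
  "rot q = mat2 (hecke_lambda q) (-1) 1 0"

definition rot_inv :: "nat \<Rightarrow> real^2^2" where
  "rot_inv q = mat2 0 1 (-1) (hecke_lambda q)"

definition sine_quot :: "nat \<Rightarrow> real \<Rightarrow> real" where
  "sine_quot q x = sin (x * (pi / real q)) / sin (pi / real q)"

text \<open>This is \<open>rot q ^ k ** invol\<close> at \<open>x = k\<close>. A real argument allows stepping below 0 without
  truncation, which matters for multiplication by \<open>rot_inv\<close>.\<close>

definition block :: "nat \<Rightarrow> real \<Rightarrow> real^2^2" where
  "block q x = mat2 (sine_quot q x) (sine_quot q (x + 1)) (sine_quot q (x - 1)) (sine_quot q x)"

fun block_prod :: "nat \<Rightarrow> nat list \<Rightarrow> real^2^2" where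
  "block_prod q [] = mat 1"
| "block_prod q (k # ks) = block q (real k) ** block_prod q ks"

text \<open>The shape that every matrix representing an element of the Hecke group turns out to have.
  Both signs are included, so the set can be used for matrices instead of classes.\<close>

definition hecke_words :: "nat \<Rightarrow> (real^2^2) set" where
  "hecke_words q = {M. \<exists>L \<in> {mat 1, invol}. \<exists>R \<in> {mat 1, invol}. \<exists>ks. set ks \<subseteq> {1..<q} \<and>
     (M = L ** block_prod q ks ** R \<or> M = - (L ** block_prod q ks ** R))}"

lemma sin_pi_div_pos: "q \<ge> 3 \<Longrightarrow> sin (pi / real q) > 0"
  by (rule sin_gt_zero) (auto simp: field_simps)

lemma sine_quot_recurrence:
  "hecke_lambda q * sine_quot q x = sine_quot q (x + 1) + sine_quot q (x - 1)"
proof -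
  define t where "t = pi / real q"
  have "2 * cos t * sin (x * t) = sin ((x + 1) * t) + sin ((x - 1) * t)"
    by (simp add: distrib_right left_diff_distrib sin_add sin_diff)
  then show ?thesis
    by (simp add: hecke_lambda_def sine_quot_def flip: t_def add_divide_distrib)
qed

lemma sine_quot_special:
  assumes "q \<ge> 3"
  shows "sine_quot q 0 = 0" "sine_quot q 1 = 1" "sine_quot q (- 1) = - 1"
    "sine_quot q (real q) = 0" "sine_quot q (real q - 1) = 1" "sine_quot q (real q + 1) = - 1"
proof -
  define t where "t = pi / real q"
  have t: "sin t > 0" "real q * t = pi"
    using sin_pi_div_pos[OF assms] assms by (auto simp: t_def)
  show "sine_quot q 0 = 0" "sine_quot q 1 = 1" "sine_quot q (- 1) = - 1"
    "sine_quot q (real q) = 0" "sine_quot q (real q - 1) = 1" "sine_quot q (real q + 1) = - 1"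
    using t
    by (simp_all add: sine_quot_def distrib_right left_diff_distrib sin_add sin_diff flip: t_def)
qed

text \<open>The sine is symmetric about \<open>\<pi> / 2\<close> and increasing before it, so on
  \<open>[\<pi> / q, \<pi> - \<pi> / q]\<close> it is smallest at the end points.\<close>

lemma sine_quot_ge_1:
  assumes "q \<ge> 3" "1 \<le> x" "x \<le> real q - 1"
  shows "sine_quot q x \<ge> 1"
proof -
  define t where "t = pi / real q"
  have t: "0 < t" "t \<le> pi / 2" and q: "real q * t = pi"
    using assms by (auto simp: t_def field_simps)
  have "x * t \<ge> t" using assms t mult_right_mono[of 1 x t] by simp
  have "x * t \<le> pi - t"
    using mult_right_mono[OF assms(3), of t] t q by (simp add: left_diff_distrib)
  have "sin t \<le> sin (x * t)"
  proof (cases "x * t \<le> pi / 2")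
    case True
    then show ?thesis
      using t pi_gt_zero \<open>x * t \<ge> t\<close> by (intro sin_monotone_2pi_le) linarith+
  next
    case False
    then have "sin t \<le> sin (pi - x * t)"
      using t pi_gt_zero \<open>x * t \<le> pi - t\<close> by (intro sin_monotone_2pi_le) linarith+
    then show ?thesis by simp
  qed
  then show ?thesis using sin_pi_div_pos[OF assms(1)] by (simp add: sine_quot_def t_def)
qed

text \<open>The addition formula for the sine: rotating a block moves it to the next index.\<close>

lemma rot_block: "rot q ** block q x = block q (x + 1)"
  using sine_quot_recurrence[of q x] sine_quot_recurrence[of q "x + 1"]
  by (simp add: rot_def block_def mat2_mult mat2_inject)

lemma rot_inv_block: "rot_inv q ** block q x = block q (x - 1)"
  using sine_quot_recurrence[of q x] sine_quot_recurrence[of q "x - 1"]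
  by (simp add: rot_inv_def block_def mat2_mult mat2_inject)

text \<open>At the ends \<open>0\<close> and \<open>q\<close> of the index range the block degenerates to \<open>\<plusminus> invol\<close>; this is where a
  rotation shortens a word. The first proper block is the translation \<open>T\<close>.\<close>

lemma block_special:
  assumes "q \<ge> 3"
  shows "block q 0 = invol" "block q 1 = mat2 1 (hecke_lambda q) 0 1"
    "block q (real q) = - invol" "block q (- 1) = - block q (real q - 1)"
proof -
  have "sine_quot q 2 = hecke_lambda q"
    using sine_quot_recurrence[of q 1] sine_quot_special[OF assms] by simp
  moreover have "sine_quot q (- 2) = - hecke_lambda q"
    using sine_quot_recurrence[of q "- 1"] sine_quot_special[OF assms] by simp
  moreover have "sine_quot q (real q - 2) = hecke_lambda q"
    using sine_quot_recurrence[of q "real q - 1"] sine_quot_special[OF assms] by simp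
  ultimately show "block q 0 = invol" "block q 1 = mat2 1 (hecke_lambda q) 0 1"
    "block q (real q) = - invol" "block q (- 1) = - block q (real q - 1)"
    using sine_quot_special[OF assms]
    by (simp_all add: block_def invol_def uminus_mat2 mat2_inject)
qed

section \<open>Every element of the Hecke group is a signed word in the blocks\<close>

lemma invol_invol: "invol ** invol = - mat 1"
  by (simp add: invol_def mat2_mult mat2_one uminus_mat2)

lemmas matrix_sign = matrix_mul_uminus_left matrix_mul_uminus_right

lemma hecke_wordsI:
  assumes "L \<in> {mat 1, invol}" "R \<in> {mat 1, invol}" "set ks \<subseteq> {1..<q}"
  shows "L ** block_prod q ks ** R \<in> hecke_words q"
  using assms unfolding hecke_words_def by blast

lemma hecke_words_uminus: "M \<in> hecke_words q \<Longrightarrow> - M \<in> hecke_words q"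
  unfolding hecke_words_def by force

lemma hecke_words_mult_closed:
  assumes step: "\<And>L R ks. \<lbrakk>L \<in> {mat 1, invol}; R \<in> {mat 1, invol}; set ks \<subseteq> {1..<q}\<rbrakk>
      \<Longrightarrow> X ** (L ** block_prod q ks ** R) \<in> hecke_words q"
    and M: "M \<in> hecke_words q"
  shows "X ** M \<in> hecke_words q"
proof -
  obtain L R ks where "L \<in> {mat 1, invol}" "R \<in> {mat 1, invol}" "set ks \<subseteq> {1..<q}"
    and eq: "M = L ** block_prod q ks ** R \<or> M = - (L ** block_prod q ks ** R)"
    using M unfolding hecke_words_def by blast
  then have "X ** (L ** block_prod q ks ** R) \<in> hecke_words q" by (intro step)
  with eq show ?thesis by (auto simp: matrix_sign intro: hecke_words_uminus)
qed

lemma hecke_words_invol: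
  assumes "M \<in> hecke_words q"
  shows "invol ** M \<in> hecke_words q"
proof (rule hecke_words_mult_closed[OF _ assms])
  fix L R :: "real^2^2" and ks
  assume *: "L \<in> {mat 1, invol}" "R \<in> {mat 1, invol}" "set ks \<subseteq> {1..<q}"
  show "invol ** (L ** block_prod q ks ** R) \<in> hecke_words q"
  proof (cases "L = mat 1")
    case True
    then show ?thesis using hecke_wordsI[of invol R ks q] * by (simp add: matrix_mul_assoc)
  next
    case False
    then have "invol ** (L ** block_prod q ks ** R) = - (mat 1 ** block_prod q ks ** R)"
      using * by (simp add: matrix_mul_assoc invol_invol matrix_sign)
    then show ?thesis
      using hecke_wordsI[of "mat 1" R ks q] * by (metis hecke_words_uminus insertI1)
  qed
qed

lemma hecke_words_block:
  assumes "q \<ge> 3" "R \<in> {mat 1, invol}" "set ks \<subseteq> {1..<q}" "k \<le> q"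
  shows "block q (real k) ** block_prod q ks ** R \<in> hecke_words q"
proof -
  consider "k = 0" | "k \<in> {1..<q}" | "k = q" using assms by force
  then show ?thesis
  proof cases
    case 1
    then show ?thesis using hecke_wordsI[of invol R ks q] assms by (simp add: block_special)
  next
    case 2
    then show ?thesis
      using hecke_wordsI[of "mat 1" R "k # ks" q] assms by (simp add: matrix_mul_assoc)
  next
    case 3
    then show ?thesis
      using hecke_words_uminus[OF hecke_wordsI[of invol R ks q]] assms
      by (simp add: block_special matrix_sign)
  qed
qed

text \<open>Gives the empty word a leading \<open>invol\<close>, that is a block of index 0, to rotate.\<close>

lemma eq_minus_mult_invol_invol: "X = - (X ** invol ** invol)" for X :: "real^2^2"
  by (simp add: invol_invol matrix_sign flip: matrix_mul_assoc)

text \<open>Left multiplication by \<open>rot\<close> and \<open>rot_inv\<close> only affects the leading block. A word starting with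
  \<open>invol\<close> starts with the block of index 0, and the empty word is \<open>- (invol ** invol)\<close>, so there is
  always a leading block with index below \<open>q\<close>, and it suffices to know where these are sent.\<close>

lemma hecke_words_shift:
  assumes q: "q \<ge> 3"
    and up: "\<And>k. k < q \<Longrightarrow> \<exists>j\<le>q. X ** block q (real k) = block q (real j) \<or>
      X ** block q (real k) = - block q (real j)"
    and M: "M \<in> hecke_words q"
  shows "X ** M \<in> hecke_words q"
proof (rule hecke_words_mult_closed[OF _ M])
  have step: "X ** (block q (real k) ** block_prod q ks ** R) \<in> hecke_words q"
    if "k < q" "R \<in> {mat 1, invol}" "set ks \<subseteq> {1..<q}" for k ks R
  proof -
    from up[OF that(1)] obtain j where "j \<le> q" and
      j: "X ** block q (real k) = block q (real j) \<or> X ** block q (real k) = - block q (real j)"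
      by blast
    then have "block q (real j) ** block_prod q ks ** R \<in> hecke_words q"
      using hecke_words_block q that by blast
    with j show ?thesis
      by (auto simp: matrix_mul_assoc matrix_sign intro: hecke_words_uminus)
  qed
  fix L R :: "real^2^2" and ks
  assume *: "L \<in> {mat 1, invol}" "R \<in> {mat 1, invol}" "set ks \<subseteq> {1..<q}"
  have b0: "block q (real 0) = invol" using block_special[OF q] by simp
  show "X ** (L ** block_prod q ks ** R) \<in> hecke_words q"
  proof (cases "L = mat 1")
    case False
    then show ?thesis using step[of 0 R ks] * q b0 by auto
  next
    case L: True
    show ?thesis
    proof (cases ks)
      case (Cons k ks')
      then show ?thesis using step[of k R ks'] * L by (auto simp: matrix_mul_assoc)
    next
      case Nil
      show ?thesis
      proof (cases "R = mat 1")
        case True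
        then show ?thesis
          using step[of 0 invol "[]"] q L Nil b0 eq_minus_mult_invol_invol[of X]
          by (metis block_prod.simps(1) empty_subsetI hecke_words_uminus insertI1 insertI2
              list.set(1) matrix_mul_assoc matrix_mul_rid not_numeral_le_zero neq0_conv)
      next
        case False
        then show ?thesis using step[of 0 "mat 1" "[]"] q L Nil b0 * by simp
      qed
    qed
  qed
qed

lemma hecke_words_rot:
  assumes "q \<ge> 3" "M \<in> hecke_words q"
  shows "rot q ** M \<in> hecke_words q"
proof (rule hecke_words_shift[OF assms(1) _ assms(2)])
  fix k assume "k < q"
  then show "\<exists>j\<le>q. rot q ** block q (real k) = block q (real j) \<or>
      rot q ** block q (real k) = - block q (real j)"
    by (intro exI[of _ "Suc k"]) (simp add: rot_block add.commute)
qed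

lemma hecke_words_rot_inv:
  assumes "q \<ge> 3" "M \<in> hecke_words q"
  shows "rot_inv q ** M \<in> hecke_words q"
proof (rule hecke_words_shift[OF assms(1) _ assms(2)])
  \<comment> \<open>The index wraps around modulo \<open>q\<close> at the cost of a sign.\<close>
  fix k assume "k < q"
  show "\<exists>j\<le>q. rot_inv q ** block q (real k) = block q (real j) \<or>
      rot_inv q ** block q (real k) = - block q (real j)"
  proof (cases k)
    case 0
    then show ?thesis
      using assms block_special(4)[of q]
      by (intro exI[of _ "q - 1"]) (simp add: rot_inv_block of_nat_diff)
  next
    case (Suc j)
    then show ?thesis using \<open>k < q\<close> by (intro exI[of _ j]) (simp add: rot_inv_block)
  qed
qed

lemma psl_class_mult: "psl_class M \<otimes>\<^bsub>PSL2R\<^esub> psl_class N = psl_class (M ** N)"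
  by (auto simp: PSL2R_def FactGroup_def set_mult_def SL2R_def psl_class_eq matrix_sign)

lemma psl_class_one: "\<one>\<^bsub>PSL2R\<^esub> = psl_class (mat 1)"
  by (auto simp: PSL2R_def FactGroup_def psl_class_eq)

lemma inv_psl_class:
  assumes "det M = 1" "det N = 1" "N ** M = mat 1"
  shows "inv\<^bsub>PSL2R\<^esub> (psl_class M) = psl_class N"
  by (rule group.inv_equality[OF group_PSL2R])
     (simp_all add: psl_class_mult psl_class_one psl_class_in_carrier assms)

text \<open>Left multiplication by any group element preserves \<open>hecke_words\<close>: this property passes to
  products, and it holds for the generators because \<open>T = rot q ** invol\<close> and
  \<open>T\<^sup>-\<^sup>1 = - (invol ** rot_inv q)\<close>. Applying it to the identity matrix proves the claim.\<close>

lemma hecke_group_subset_words: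
  assumes q: "q \<ge> 3" and g: "g \<in> hecke_group q" and X: "X \<in> g"
  shows "X \<in> hecke_words q"
proof -
  let ?S = "mat2 0 1 (-1) 0" and ?T = "mat2 1 (hecke_lambda q) 0 1"
  have T: "?T = rot q ** invol"
    by (simp add: rot_def invol_def mat2_mult)
  have Tinv: "mat2 1 (- hecke_lambda q) 0 1 = - (invol ** rot_inv q)"
    by (simp add: rot_inv_def invol_def mat2_mult uminus_mat2)
  have "X ** M \<in> hecke_words q" if "M \<in> hecke_words q" "X \<in> g" for X M
    using g that unfolding hecke_group_def
  proof (induction arbitrary: X M rule: generate.induct)
    case one
    then show ?case
      by (auto simp: psl_class_one psl_class_eq matrix_sign intro: hecke_words_uminus)
  next
    case (incl h)
    then consider "X = invol \<or> X = - invol" | "X = ?T \<or> X = - ?T"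
      by (auto simp: psl_class_eq invol_def)
    then show ?case
      unfolding T using incl.prems(1) q
      by cases (auto simp: matrix_sign
          simp flip: matrix_mul_assoc
          intro!: hecke_words_uminus hecke_words_invol hecke_words_rot)
  next
    case (inv h)
    have "inv\<^bsub>PSL2R\<^esub> (psl_class ?S) = psl_class (- invol)"
      by (rule inv_psl_class) (simp_all add: det_mat2 invol_def uminus_mat2 mat2_mult mat2_one)
    moreover have "inv\<^bsub>PSL2R\<^esub> (psl_class ?T) = psl_class (mat2 1 (- hecke_lambda q) 0 1)"
      by (rule inv_psl_class) (simp_all add: det_mat2 mat2_mult mat2_one)
    ultimately consider "X = invol \<or> X = - invol"
      | "X = invol ** rot_inv q \<or> X = - (invol ** rot_inv q)"
      using inv by (auto simp: psl_class_eq Tinv)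
    then show ?case
      using inv.prems(1) q
      by cases (auto simp: matrix_sign
          simp flip: matrix_mul_assoc
          intro!: hecke_words_uminus hecke_words_invol hecke_words_rot_inv)
  next
    case (eng h1 h2)
    then obtain X1 X2 where "X1 \<in> h1" "X2 \<in> h2" "X = X1 ** X2"
      by (auto simp: PSL2R_def FactGroup_def set_mult_def SL2R_def)
    then show ?case using eng by (simp flip: matrix_mul_assoc)
  qed
  moreover have "mat 1 \<in> hecke_words q"
    using hecke_wordsI[of "mat 1" "mat 1" "[]" q] by simp
  ultimately show ?thesis using X matrix_mul_rid by metis
qed

section \<open>Discreteness\<close>

definition gapped :: "real \<Rightarrow> bool" where
  "gapped x \<longleftrightarrow> x = 0 \<or> x \<ge> 1"

lemma gapped_nonneg: "gapped x \<Longrightarrow> x \<ge> 0"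
  by (auto simp: gapped_def)

lemma gapped_add: "gapped x \<Longrightarrow> gapped y \<Longrightarrow> gapped (x + y)"
  by (auto simp: gapped_def)

lemma gapped_mult: "gapped x \<Longrightarrow> gapped y \<Longrightarrow> gapped (x * y)"
  using mult_mono[of 1 x 1 y] by (auto simp: gapped_def)

text \<open>An off-diagonal entry vanishes only for \<open>k = 1\<close> (lower left) or \<open>k = q - 1\<close> (upper right). These
  indices differ as \<open>q \<ge> 3\<close>, so one off-diagonal entry is always at least 1, and this is what
  makes long words large.\<close>

lemma block_entries:
  assumes "q \<ge> 3" "k \<in> {1..<q}"
  obtains a b c where "block q (real k) = mat2 a b c a" "a \<ge> 1" "gapped b" "gapped c" "b + c \<ge> 1"
proof -
  have "real k + 1 \<le> real q" using assms by (metis atLeastLessThan_iff Suc_leI of_nat_Suc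
        of_nat_le_iff add.commute)
  then have a: "sine_quot q (real k) \<ge> 1"
    using assms by (intro sine_quot_ge_1) auto
  have b: "if k = q - 1 then sine_quot q (real k + 1) = 0 else sine_quot q (real k + 1) \<ge> 1"
  proof (cases "k = q - 1")
    case True
    then show ?thesis using assms sine_quot_special[of q] by (simp add: of_nat_diff)
  next
    case False
    then have "real (k + 2) \<le> real q" using assms by (subst of_nat_le_iff) auto
    then show ?thesis using False assms by (auto intro!: sine_quot_ge_1)
  qed
  have c: "if k = 1 then sine_quot q (real k - 1) = 0 else sine_quot q (real k - 1) \<ge> 1"
  proof (cases "k = 1")
    case True
    then show ?thesis using assms sine_quot_special[of q] by simp
  next
    case False
    then have "real k \<ge> 2" using assms by auto
    then show ?thesis using False assms \<open>real k + 1 \<le> real q\<close> by (auto intro!: sine_quot_ge_1)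
  qed
  show ?thesis
    by (rule that[of "sine_quot q (real k)" "sine_quot q (real k + 1)" "sine_quot q (real k - 1)"])
       (use a b c assms in \<open>auto simp: block_def gapped_def split: if_splits\<close>)
qed

text \<open>Entrywise a block dominates the identity plus an off-diagonal part of total weight at least 1.
  Multiplying by the identity keeps the entry sum, and the off-diagonal part adds multiples of
  the row sums, which are at least 1 because the diagonal entries are. So each block adds at
  least 1 to the entry sum.\<close>

lemma block_prod_entries:
  assumes "q \<ge> 3" "set ks \<subseteq> {1..<q}"
  shows "\<exists>a b c d. block_prod q ks = mat2 a b c d \<and> a \<ge> 1 \<and> d \<ge> 1 \<and> gapped b \<and> gapped c \<and>
     a + b + c + d \<ge> real (length ks)"
  using assms(2)
proof (induction ks)
  case Nil
  show ?case by (simp add: mat2_one mat2_inject gapped_def)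
next
  case (Cons k ks)
  then obtain a b c d where IH: "block_prod q ks = mat2 a b c d" "a \<ge> 1" "d \<ge> 1" "gapped b"
    "gapped c" "a + b + c + d \<ge> real (length ks)" by auto
  obtain x y z where g: "block q (real k) = mat2 x y z x" "x \<ge> 1" "gapped y" "gapped z" "y + z \<ge> 1"
    using block_entries[of q k] assms(1) Cons.prems by auto
  note nonneg = gapped_nonneg[OF IH(4)] gapped_nonneg[OF IH(5)] gapped_nonneg[OF g(3)]
    gapped_nonneg[OF g(4)]
  have xd: "gapped a" "gapped d" "gapped x" using IH g by (auto simp: gapped_def)
  have "x * a \<ge> 1" "x * d \<ge> 1"
    using mult_mono[of 1 x 1 a] mult_mono[of 1 x 1 d] IH g by auto
  moreover have "y * c \<ge> 0" "z * b \<ge> 0" using nonneg by auto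
  moreover have "(x * a + y * c) + (x * b + y * d) + (z * a + x * c) + (z * b + x * d)
      \<ge> real (length ks) + 1"
  proof -
    have "x * (a + b + c + d) \<ge> 1 * (a + b + c + d)"
      using g nonneg IH by (intro mult_right_mono) auto
    moreover have "y * (c + d) \<ge> y * 1" "z * (a + b) \<ge> z * 1"
      using nonneg IH(2,3) by (intro mult_left_mono; linarith)+
    ultimately show ?thesis using IH(6) g(5) unfolding ring_distribs by linarith
  qed
  ultimately show ?case
    using IH g xd by (simp add: mat2_mult mat2_inject gapped_add gapped_mult)
qed

text \<open>Absolute values make this invariant under sign changes and under multiplication by
  \<open>invol\<close> on either side.\<close>

definition entry_sum :: "real^2^2 \<Rightarrow> real" where
  "entry_sum M = \<bar>M $ 1 $ 1\<bar> + \<bar>M $ 1 $ 2\<bar> + \<bar>M $ 2 $ 1\<bar> + \<bar>M $ 2 $ 2\<bar>"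

lemma entry_sum_word:
  assumes "q \<ge> 3" "L \<in> {mat 1, invol}" "R \<in> {mat 1, invol}" "set ks \<subseteq> {1..<q}"
  shows "real (length ks) \<le> entry_sum (L ** block_prod q ks ** R)"
proof -
  obtain a b c d where "block_prod q ks = mat2 a b c d" "a \<ge> 1" "d \<ge> 1" "gapped b" "gapped c"
    "a + b + c + d \<ge> real (length ks)"
    using block_prod_entries[OF assms(1,4)] by auto
  then show ?thesis using assms(2,3)
    by (auto simp: entry_sum_def invol_def mat2_mult dest!: gapped_nonneg)
qed

lemma hecke_words_gapped:
  assumes "q \<ge> 3" "mat2 a b c d \<in> hecke_words q"
  shows "gapped \<bar>a\<bar>" "gapped \<bar>b\<bar>" "gapped \<bar>c\<bar>" "gapped \<bar>d\<bar>"
proof -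
  obtain L R ks where *: "L \<in> {mat 1, invol}" "R \<in> {mat 1, invol}" "set ks \<subseteq> {1..<q}"
    "mat2 a b c d = L ** block_prod q ks ** R \<or> mat2 a b c d = - (L ** block_prod q ks ** R)"
    using assms(2) unfolding hecke_words_def by blast
  obtain a' b' c' d' where
    P: "block_prod q ks = mat2 a' b' c' d'" and "a' \<ge> 1" "d' \<ge> 1" "gapped b'" "gapped c'"
    using block_prod_entries[OF assms(1) *(3)] by auto
  then have gap: "\<forall>x \<in> {a', b', c', d'}. gapped \<bar>x\<bar>" by (auto simp: gapped_def)
  have sub: "{\<bar>a\<bar>, \<bar>b\<bar>, \<bar>c\<bar>, \<bar>d\<bar>} \<subseteq> abs ` {a', b', c', d'}"
    using *(1,2,4) unfolding P
    by (elim insertE emptyE disjE)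
       (simp_all add: invol_def mat2_mult mat2_inject uminus_mat2)
  have "gapped x" if "x \<in> {\<bar>a\<bar>, \<bar>b\<bar>, \<bar>c\<bar>, \<bar>d\<bar>}" for x
    using subsetD[OF sub that] gap by (elim imageE) metis
  then show "gapped \<bar>a\<bar>" "gapped \<bar>b\<bar>" "gapped \<bar>c\<bar>" "gapped \<bar>d\<bar>"
    by (meson insertI1 insertI2)+
qed

lemma finite_hecke_words_bounded:
  assumes "q \<ge> 3"
  shows "finite {M \<in> hecke_words q. entry_sum M \<le> K}"
proof -
  define W where "W = {ks. set ks \<subseteq> {1..<q} \<and> length ks \<le> nat \<lfloor>K\<rfloor>}"
  define E :: "(real^2^2) set" where
    "E = (\<lambda>(L, ks, R). L ** block_prod q ks ** R) ` ({mat 1, invol} \<times> W \<times> {mat 1, invol})"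
  have "finite W" unfolding W_def by (rule finite_lists_length_le) simp
  then have "finite (E \<union> uminus ` E)" unfolding E_def by simp
  moreover have "{M \<in> hecke_words q. entry_sum M \<le> K} \<subseteq> E \<union> uminus ` E"
  proof
    fix M assume "M \<in> {M \<in> hecke_words q. entry_sum M \<le> K}"
    then obtain L R ks where *: "L \<in> {mat 1, invol}" "R \<in> {mat 1, invol}" "set ks \<subseteq> {1..<q}"
      "M = L ** block_prod q ks ** R \<or> M = - (L ** block_prod q ks ** R)" and K: "entry_sum M \<le> K"
      unfolding hecke_words_def by blast
    have "entry_sum (- N) = entry_sum N" for N by (simp add: entry_sum_def)
    then have "real (length ks) \<le> K"
      using entry_sum_word[OF assms *(1-3)] *(4) K by auto
    then have "ks \<in> W" using *(3) by (simp add: W_def le_nat_floor)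
    then have "L ** block_prod q ks ** R \<in> E" unfolding E_def using *(1,2) by force
    then show "M \<in> E \<union> uminus ` E" using *(4) by auto
  qed
  ultimately show ?thesis by (rule finite_subset[rotated])
qed

section \<open>Reduced forms\<close>

text \<open>The matrix determines \<open>A\<close> and \<open>C\<close> by its off-diagonal entries, \<open>B\<close> by the difference of the
  diagonal entries, and \<open>s\<close> by the sign of the trace. Its negative belongs to \<open>(- f, - s)\<close>, which
  represents the same projective form.\<close>

lemma inj_psi2: "inj psi2"
proof (rule injI)
  show "psi2 F = psi2 G \<Longrightarrow> F = G" for F G
  proof (transfer)
    have inj: "p = p'" if p: "poqf_rel p p" "poqf_rel p' p'" and eq: "psi2_matrix p = psi2_matrix p'"
      for p p'
    proof -
      obtain A B C s A' B' C' s' where pp: "p = ((A, B, C), s)" "p' = ((A', B', C'), s')"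
        by (metis prod.collapse)
      define r r' where "r = sqrt (disc (A, B, C) + 4)" "r' = sqrt (disc (A', B', C') + 4)"
      have pos: "r > 0" "r' > 0" using p by (auto simp: pp r_r'_def)
      have s: "s \<in> {1, -1}" "s' \<in> {1, -1}" using p by (auto simp: pp)
      have "A = A'" "C = C'" "- B + of_int s * r = - B' + of_int s' * r'"
        "B + of_int s * r = B' + of_int s' * r'"
        using eq by (auto simp: pp Let_def mat2_inject r_r'_def)
      then have *: "A = A'" "C = C'" "B = B'" "of_int s * r = of_int s' * r'" by linarith+
      then show ?thesis using s pos by (auto simp: pp)
    qed
    fix p p' assume p: "poqf_rel p p" "poqf_rel p' p'"
      and "psl_class (psi2_matrix p) = psl_class (psi2_matrix p')"
    then have "psi2_matrix p' = psi2_matrix p \<or> psi2_matrix p' = - psi2_matrix p"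
      by (auto simp: psl_class_eq doubleton_eq_iff)
    moreover obtain f s where fs: "p = (f, s)" by (cases p)
    have neg: "poqf_rel (- f, - s) (- f, - s)" "poqf_rel p (- f, - s)"
      using p by (auto simp: fs disc_uminus)
    ultimately show "poqf_rel p p'"
      using inj[OF p(2,1)] inj[OF p(2) neg(1)] p(1) neg(2) psi2_matrix_uminus[of f s]
      by (auto simp: fs)
  qed
qed

text \<open>The product of the two zeros is \<open>C / A\<close>.\<close>

lemma opposite_zeros:
  assumes "A \<noteq> 0" "x_plus (A, B, C) < 0 \<and> x_minus (A, B, C) > 0 \<or>
    x_minus (A, B, C) < 0 \<and> x_plus (A, B, C) > 0" "disc (A, B, C) > 0"
  shows "A * C < 0"
proof -
  define d where "d = sqrt (disc (A, B, C))"
  have "x_plus (A, B, C) = ereal ((- B + d) / (2 * A))"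
    "x_minus (A, B, C) = ereal ((- B - d) / (2 * A))"
    using assms(1) by (simp_all add: d_def)
  then have "((- B + d) / (2 * A)) * ((- B - d) / (2 * A)) < 0"
    using assms(2) mult_neg_pos mult_pos_neg by (metis ereal_less(2) less_ereal.simps(1) zero_ereal_def)
  moreover have "d\<^sup>2 = B\<^sup>2 - 4 * A * C" using assms(3) by (simp add: d_def)
  then have "(- B + d) * (- B - d) = 4 * A * C"
    by (simp add: algebra_simps power2_eq_square)
  then have "((- B + d) / (2 * A)) * ((- B - d) / (2 * A)) = A * C / A\<^sup>2"
    by (simp add: power2_eq_square)
  ultimately have "A * C / A\<^sup>2 < 0" by metis
  then show ?thesis by (simp add: divide_less_0_iff)
qed

text \<open>The gap turns the bound on the product \<open>\<bar>A\<bar> * \<bar>C\<bar> \<le> D / 4\<close> into a bound on each factor. The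
  diagonal entries are bounded by \<open>r = sqrt (disc + 4)\<close>, since \<open>\<bar>B\<bar> \<le> r\<close> when \<open>A * C < 0\<close>.\<close>

lemma reduced_gamma_form_bounded:
  assumes q: "q \<ge> 3" and F: "F \<in> gamma_forms q" "reduced_form F" "poqf_disc F \<le> D"
  shows "\<exists>M \<in> hecke_words q. entry_sum M \<le> D + 2 * sqrt (D + 4) \<and> psi2 F = psl_class M"
proof -
  have "\<exists>A B C s. psi2 F = psl_class (psi2_matrix ((A, B, C), s)) \<and> disc (A, B, C) \<le> D \<and>
    disc (A, B, C) > 0 \<and> s \<in> {1, -1} \<and>
     (x_plus (A, B, C) < 0 \<and> x_minus (A, B, C) > 0 \<or>
      x_minus (A, B, C) < 0 \<and> x_plus (A, B, C) > 0)"
    using F(2,3) unfolding reduced_form_def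
  proof transfer
    fix p D
    assume p: "poqf_rel p p"
      and red: "0 < (case p of (f, s) \<Rightarrow> if s = 1 then x_plus f else x_minus f) \<and>
          (case p of (f, s) \<Rightarrow> if s = 1 then x_minus f else x_plus f) < 0"
      and le: "(case p of (f, s) \<Rightarrow> disc f) \<le> D"
    obtain A B C s where eq: "p = ((A, B, C), s)" by (metis prod.collapse)
    have "disc (A, B, C) > 0" "s \<in> {1, -1}"
      using p unfolding eq poqf_rel.simps by blast+
    moreover have "disc (A, B, C) \<le> D" using le unfolding eq prod.case .
    moreover have "x_plus (A, B, C) < 0 \<and> x_minus (A, B, C) > 0 \<or>
      x_minus (A, B, C) < 0 \<and> x_plus (A, B, C) > 0"
      using red unfolding eq prod.case by (cases "s = 1") (simp_all del: x_plus.simps x_minus.simps)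
    ultimately show "\<exists>A B C s. psl_class (psi2_matrix p) = psl_class (psi2_matrix ((A, B, C), s)) \<and>
      disc (A, B, C) \<le> D \<and> disc (A, B, C) > 0 \<and> s \<in> {1, -1} \<and>
     (x_plus (A, B, C) < 0 \<and> x_minus (A, B, C) > 0 \<or>
      x_minus (A, B, C) < 0 \<and> x_plus (A, B, C) > 0)"
      unfolding eq by blast
  qed
  then obtain A B C s where psi: "psi2 F = psl_class (psi2_matrix ((A, B, C), s))"
    and disc: "disc (A, B, C) \<le> D" "disc (A, B, C) > 0" and s: "s = 1 \<or> s = -1"
    and opp: "x_plus (A, B, C) < 0 \<and> x_minus (A, B, C) > 0 \<or>
      x_minus (A, B, C) < 0 \<and> x_plus (A, B, C) > 0"
    by blast
  define r where "r = sqrt (disc (A, B, C) + 4)"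
  have r2: "r\<^sup>2 = disc (A, B, C) + 4" and r: "r > 2"
    using disc unfolding r_def by (auto intro: real_less_rsqrt)
  have "r \<le> sqrt (D + 4)" using disc by (simp add: r_def)
  define M where "M = mat2 ((- B + of_int s * r) / 2) (- C) A ((B + of_int s * r) / 2)"
  have M: "psi2_matrix ((A, B, C), s) = M" by (simp add: M_def r_def Let_def)
  have psiM: "psi2 F = psl_class M" unfolding psi M ..
  have "psi2 F \<in> hecke_group q" using F(1) by (simp add: gamma_forms_def hecke_hyperbolic_def)
  then have Mw: "M \<in> hecke_words q"
    by (rule hecke_group_subset_words[OF q]) (simp add: psiM psl_class_eq)
  note gap = hecke_words_gapped[OF q Mw[unfolded M_def]]
  \<comment> \<open>Otherwise the gap for the diagonal entries, whose product is 1, forces the trace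
    \<open>of_int s * r\<close> to be at most 2 in absolute value, although \<open>r > 2\<close>.\<close>
  have "A \<noteq> 0"
  proof
    assume A: "A = 0"
    let ?a = "(- B + of_int s * r) / 2" and ?d = "(B + of_int s * r) / 2"
    have prod: "?a * ?d = 1"
      using r2 A s by (auto simp: field_simps power2_eq_square)
    have "\<bar>?a\<bar> \<ge> 1" "\<bar>?d\<bar> \<ge> 1" using gap(1,4) prod by (auto simp: gapped_def)
    moreover have "\<bar>?a\<bar> * \<bar>?d\<bar> = 1" using prod by (metis abs_mult abs_one)
    ultimately have "\<bar>?a\<bar> \<le> 1" "\<bar>?d\<bar> \<le> 1"
      using mult_left_mono[of 1 "\<bar>?d\<bar>" "\<bar>?a\<bar>"] mult_right_mono[of 1 "\<bar>?a\<bar>" "\<bar>?d\<bar>"] by auto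
    moreover have "?a + ?d = of_int s * r" by (simp add: field_simps)
    ultimately show False using r s by auto
  qed
  then have AC: "A * C < 0" using opposite_zeros opp disc by blast
  then have "\<bar>A\<bar> \<ge> 1" "\<bar>C\<bar> \<ge> 1" using gap(2,3) by (auto simp: gapped_def)
  then have "\<bar>A\<bar> \<le> \<bar>A\<bar> * \<bar>C\<bar>" "\<bar>C\<bar> \<le> \<bar>A\<bar> * \<bar>C\<bar>"
    using mult_left_mono[of 1 "\<bar>C\<bar>" "\<bar>A\<bar>"] mult_right_mono[of 1 "\<bar>A\<bar>" "\<bar>C\<bar>"] by auto
  moreover have "4 * (\<bar>A\<bar> * \<bar>C\<bar>) \<le> D"
  proof -
    have "\<bar>A\<bar> * \<bar>C\<bar> = - (A * C)" using AC by (simp flip: abs_mult)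
    moreover have "disc (A, B, C) = B\<^sup>2 - 4 * (A * C)" by simp
    ultimately show ?thesis using disc(1) zero_le_power2[of B] by linarith
  qed
  moreover have "B\<^sup>2 \<le> r\<^sup>2" using AC by (simp add: r2)
  then have "\<bar>B\<bar> \<le> r" using r abs_le_square_iff[of B r] by simp
  then have "\<bar>(- B + of_int s * r) / 2\<bar> \<le> r" "\<bar>(B + of_int s * r) / 2\<bar> \<le> r"
    using s r by (auto simp: abs_le_iff)
  moreover have "entry_sum M = \<bar>(- B + of_int s * r) / 2\<bar> + \<bar>C\<bar> + \<bar>A\<bar> + \<bar>(B + of_int s * r) / 2\<bar>"
    by (simp add: entry_sum_def M_def)
  ultimately have "entry_sum M \<le> D + 2 * sqrt (D + 4)"
    using \<open>r \<le> sqrt (D + 4)\<close> \<open>\<bar>A\<bar> \<ge> 1\<close> \<open>\<bar>C\<bar> \<ge> 1\<close> by linarith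
  then show ?thesis using Mw psiM by blast
qed

theorem theorem5p10:
  fixes q :: nat and D :: real
  assumes "q \<ge> 3" and "D > 0"
  shows "finite {F \<in> gamma_forms q. reduced_form F \<and> poqf_disc F \<le> D}"
proof (rule inj_on_finite[of psi2])
  show "inj_on psi2 {F \<in> gamma_forms q. reduced_form F \<and> poqf_disc F \<le> D}"
    using inj_psi2 by (rule inj_on_subset) simp
  show "psi2 ` {F \<in> gamma_forms q. reduced_form F \<and> poqf_disc F \<le> D}
    \<subseteq> psl_class ` {M \<in> hecke_words q. entry_sum M \<le> D + 2 * sqrt (D + 4)}"
    using reduced_gamma_form_bounded[OF assms(1)] by blast
  show "finite (psl_class ` {M \<in> hecke_words q. entry_sum M \<le> D + 2 * sqrt (D + 4)})"
    using finite_hecke_words_bounded[OF assms(1)] by blast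
qed

end
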